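(* Let $\mathscr{K}$ be a class of algebras of the same signature that is closed under taking homomorphic images and has definable completely meet irreducible congruences. Then there is a first order query $\phi(x,y)$ with two free variables $x,y$ such that for every $\mathbf{A}\in\mathscr{K}$ and every $a\neq b$ in $A$, the query $\phi(a,b)$ defines a subdirectly irreducible quotient of $\mathbf{A}$ in which the monolith is generated by representatives of the congruence classes of $a$ and $b$.
   Context: A class $\mathscr{K}$ of algebras of the same signature has definable completely meet irreducible congruences if there is a formula $\pi_{x,y}(u,v)$ with four free variables $x,y,u,v$ such that for every $\mathbf{A}\in\mathscr{K}$ and every $a,b\in A$ with $a\neq b$, the binary relation $\{(c,d)\in A^2\mid \mathbf{A}\models\pi_{a,b}(c,d)\}$ is a congruence of $\mathbf{A}$ that is maximal with respect to not containing the pair $(a,b)$. An algebra is subdirectly irreducible if it has a unique minimum nontrivial congruence, called its monolith. First order queries. Queries are formulated for relational signatures; every operation of arity $n$ is considered as a relation of arity $n+1$ using its graph. Formulas are allowed recourse to a strict linear order $<$ on the universe. For purely relational signatures $\mathcal{R}$ and $\mathcal{S}$, an $n$-ary first order query is a family consisting of a first order formula $\varphi(\vec{x})$ in the signature $\mathcal{R}\cup\{<\}$, where $\vec{x}=x_0,\dots,x_{n-1}$, and, for each $s\in\mathcal{S}$ of arity $k$, a first order formula $\psi_s(\vec{x}_1,\dots,\vec{x}_k)$ in the signature $\mathcal{R}\cup\{<\}$, where each $\vec{x}_i$ is an $n$-tuple of variables. On any $\mathcal{R}\cup\{<\}$-structure $\mathbb{B}$ with universe $B$ it defines the $\mathcal{S}$-structure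 whose universe is the solution set $U\subseteq B^n$ of $\varphi(\vec{x})$ and in which each $s\in\mathcal{S}$ is the restriction to $U$ of the solution set of $\psi_s$. A first order query with free variables $y_1,\dots,y_k$ is such a family in which all formulas may contain the additional free variables $y_1,\dots,y_k$; each evaluation $(y_1,\dots,y_k)\mapsto(a_1,\dots,a_k)$ in a structure gives rise to a first order query with parameters $a_1,\dots,a_k$. In the claim, $\mathcal{R}=\mathcal{S}$ is the signature of $\mathscr{K}$ (with operations replaced by their graphs), and $\phi(a,b)$ is the query obtained by evaluating $(x,y)\mapsto(a,b)$.
   Formalization: The strict linear order on the universe is required to be a well-order (automatic for finite algebras), since the claim fails for arbitrary linear orders on infinite algebras; the class is taken as a set of algebras with universes inside one arbitrary fixed type. *)

theory Defs
  imports Main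
begin

section \<open>Algebras\<close>

text \<open>
  A signature is a type \<^typ>\<open>'f\<close> of operation symbols with an arity function.  The function
  \<open>opn A f\<close> is only meaningful on lists over the universe whose length is the arity
  of \<open>f\<close>; no definition below depends on its other values.
\<close>

record ('f, 'a) alg =
  universe :: "'a set"
  opn :: "'f \<Rightarrow> 'a list \<Rightarrow> 'a"

definition algebra :: "('f \<Rightarrow> nat) \<Rightarrow> ('f, 'a) alg \<Rightarrow> bool" where
  "algebra ar A \<longleftrightarrow> universe A \<noteq> {} \<and>
     (\<forall>f. \<forall>xs \<in> lists (universe A). length xs = ar f \<longrightarrow> opn A f xs \<in> universe A)"

definition alg_hom :: "('f \<Rightarrow> nat) \<Rightarrow> ('a \<Rightarrow> 'b) \<Rightarrow> ('f, 'a) alg \<Rightarrow> ('f, 'b) alg \<Rightarrow> bool" where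
  "alg_hom ar h A B \<longleftrightarrow> h ` universe A \<subseteq> universe B \<and>
     (\<forall>f. \<forall>xs \<in> lists (universe A). length xs = ar f \<longrightarrow> h (opn A f xs) = opn B f (map h xs))"

definition alg_iso :: "('f \<Rightarrow> nat) \<Rightarrow> ('a \<Rightarrow> 'b) \<Rightarrow> ('f, 'a) alg \<Rightarrow> ('f, 'b) alg \<Rightarrow> bool" where
  "alg_iso ar h A B \<longleftrightarrow> alg_hom ar h A B \<and> bij_betw h (universe A) (universe B)"

text \<open>
  A homomorphic image of \<open>A\<close> has at most as many elements as \<open>A\<close>, so up to isomorphism all of
  them have a universe inside the type \<^typ>\<open>'a\<close>.
\<close>

definition closed_under_hom_images :: "('f \<Rightarrow> nat) \<Rightarrow> ('f, 'a) alg set \<Rightarrow> bool" where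
  "closed_under_hom_images ar K \<longleftrightarrow>
     (\<forall>A \<in> K. \<forall>B h. algebra ar B \<longrightarrow> alg_hom ar h A B \<longrightarrow> h ` universe A = universe B \<longrightarrow> B \<in> K)"

definition congruence :: "('f \<Rightarrow> nat) \<Rightarrow> ('f, 'a) alg \<Rightarrow> ('a \<times> 'a) set \<Rightarrow> bool" where
  "congruence ar A \<theta> \<longleftrightarrow> equiv (universe A) \<theta> \<and>
     (\<forall>f xs ys. length xs = ar f \<longrightarrow> list_all2 (\<lambda>x y. (x, y) \<in> \<theta>) xs ys
        \<longrightarrow> (opn A f xs, opn A f ys) \<in> \<theta>)"

definition max_not_containing ::
    "('f \<Rightarrow> nat) \<Rightarrow> ('f, 'a) alg \<Rightarrow> 'a \<Rightarrow> 'a \<Rightarrow> ('a \<times> 'a) set \<Rightarrow> bool" where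
  "max_not_containing ar A a b \<theta> \<longleftrightarrow> congruence ar A \<theta> \<and> (a, b) \<notin> \<theta> \<and>
     (\<forall>\<theta>'. congruence ar A \<theta>' \<longrightarrow> (a, b) \<notin> \<theta>' \<longrightarrow> \<theta> \<subseteq> \<theta>' \<longrightarrow> \<theta>' = \<theta>)"

definition generated_congruence ::
    "('f \<Rightarrow> nat) \<Rightarrow> ('f, 'a) alg \<Rightarrow> 'a \<Rightarrow> 'a \<Rightarrow> ('a \<times> 'a) set" where
  "generated_congruence ar A a b = \<Inter> {\<theta>. congruence ar A \<theta> \<and> (a, b) \<in> \<theta>}"

text \<open>
  The operations of the quotient are given without choosing representatives: for a congruence
  \<open>\<theta>\<close> and a list \<open>Xs\<close> of classes the union below consists of a single class.
\<close>

definition quotient_alg :: "('f, 'a) alg \<Rightarrow> ('a \<times> 'a) set \<Rightarrow> ('f, 'a set) alg" where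
  "quotient_alg A \<theta> =
     \<lparr>universe = universe A // \<theta>, opn = (\<lambda>f Xs. \<Union>xs \<in> listset Xs. \<theta> `` {opn A f xs})\<rparr>"

definition is_monolith :: "('f \<Rightarrow> nat) \<Rightarrow> ('f, 'a) alg \<Rightarrow> ('a \<times> 'a) set \<Rightarrow> bool" where
  "is_monolith ar A \<mu> \<longleftrightarrow> congruence ar A \<mu> \<and> \<mu> \<noteq> Id_on (universe A) \<and>
     (\<forall>\<theta>. congruence ar A \<theta> \<longrightarrow> \<theta> \<noteq> Id_on (universe A) \<longrightarrow> \<mu> \<subseteq> \<theta>)"

definition subdirectly_irreducible :: "('f \<Rightarrow> nat) \<Rightarrow> ('f, 'a) alg \<Rightarrow> bool" where
  "subdirectly_irreducible ar A \<longleftrightarrow> (\<exists>!\<mu>. is_monolith ar A \<mu>)"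


section \<open>First order formulas over an algebraic signature\<close>

datatype 'f trm = Var nat | App 'f "'f trm list"

fun wf_trm :: "('f \<Rightarrow> nat) \<Rightarrow> 'f trm \<Rightarrow> bool" where
  "wf_trm ar (Var i) \<longleftrightarrow> True"
| "wf_trm ar (App f ts) \<longleftrightarrow> length ts = ar f \<and> (\<forall>t \<in> set ts. wf_trm ar t)"

fun fv_trm :: "'f trm \<Rightarrow> nat set" where
  "fv_trm (Var i) = {i}"
| "fv_trm (App f ts) = (\<Union>t \<in> set ts. fv_trm t)"

fun val :: "('f, 'a) alg \<Rightarrow> (nat \<Rightarrow> 'a) \<Rightarrow> 'f trm \<Rightarrow> 'a" where
  "val A \<sigma> (Var i) = \<sigma> i"
| "val A \<sigma> (App f ts) = opn A f (map (val A \<sigma>) ts)"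

datatype 'f afm =
    AEq "'f trm" "'f trm"
  | ANeg "'f afm"
  | AAnd "'f afm" "'f afm"
  | AAll nat "'f afm"

fun wf_afm :: "('f \<Rightarrow> nat) \<Rightarrow> 'f afm \<Rightarrow> bool" where
  "wf_afm ar (AEq s t) \<longleftrightarrow> wf_trm ar s \<and> wf_trm ar t"
| "wf_afm ar (ANeg p) \<longleftrightarrow> wf_afm ar p"
| "wf_afm ar (AAnd p q) \<longleftrightarrow> wf_afm ar p \<and> wf_afm ar q"
| "wf_afm ar (AAll i p) \<longleftrightarrow> wf_afm ar p"

fun fv_afm :: "'f afm \<Rightarrow> nat set" where
  "fv_afm (AEq s t) = fv_trm s \<union> fv_trm t"
| "fv_afm (ANeg p) = fv_afm p"
| "fv_afm (AAnd p q) = fv_afm p \<union> fv_afm q"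
| "fv_afm (AAll i p) = fv_afm p - {i}"

fun asat :: "('f, 'a) alg \<Rightarrow> (nat \<Rightarrow> 'a) \<Rightarrow> 'f afm \<Rightarrow> bool" where
  "asat A \<sigma> (AEq s t) \<longleftrightarrow> val A \<sigma> s = val A \<sigma> t"
| "asat A \<sigma> (ANeg p) \<longleftrightarrow> \<not> asat A \<sigma> p"
| "asat A \<sigma> (AAnd p q) \<longleftrightarrow> asat A \<sigma> p \<and> asat A \<sigma> q"
| "asat A \<sigma> (AAll i p) \<longleftrightarrow> (\<forall>d \<in> universe A. asat A (\<sigma>(i := d)) p)"

text \<open>
  The variables \<open>x, y, u, v\<close> of the defining formula are numbered \<open>0, 1, 2, 3\<close>, so that
  \<open>nth [a, b, c, d]\<close> is the evaluation \<open>(x, y, u, v) \<mapsto> (a, b, c, d)\<close>.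
\<close>

definition definable_cmi_congruences :: "('f \<Rightarrow> nat) \<Rightarrow> ('f, 'a) alg set \<Rightarrow> bool" where
  "definable_cmi_congruences ar K \<longleftrightarrow>
     (\<exists>\<pi>. wf_afm ar \<pi> \<and> fv_afm \<pi> \<subseteq> {0, 1, 2, 3} \<and>
       (\<forall>A \<in> K. \<forall>a \<in> universe A. \<forall>b \<in> universe A. a \<noteq> b \<longrightarrow>
          max_not_containing ar A a b
            {(c, d). c \<in> universe A \<and> d \<in> universe A \<and> asat A (nth [a, b, c, d]) \<pi>}))"


section \<open>First order queries over ordered relational structures\<close>

record ('r, 'a) rstruct =
  dom_of :: "'a set"
  rel :: "'r \<Rightarrow> 'a list set"

definition graph_struct :: "('f \<Rightarrow> nat) \<Rightarrow> ('f, 'a) alg \<Rightarrow> ('f, 'a) rstruct" where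
  "graph_struct ar A =
     \<lparr>dom_of = universe A,
      rel = (\<lambda>f. {xs @ [opn A f xs] | xs. xs \<in> lists (universe A) \<and> length xs = ar f})\<rparr>"

text \<open>
  Formulas in a relational signature expanded by an order symbol: \<open>RLess i j\<close> stands
  for \<open>x\<^sub>i < x\<^sub>j\<close>.
\<close>

datatype 'r rfm =
    REq nat nat
  | RLess nat nat
  | RRel 'r "nat list"
  | RNeg "'r rfm"
  | RAnd "'r rfm" "'r rfm"
  | RAll nat "'r rfm"

fun wf_rfm :: "('r \<Rightarrow> nat) \<Rightarrow> 'r rfm \<Rightarrow> bool" where
  "wf_rfm ar (REq i j) \<longleftrightarrow> True"
| "wf_rfm ar (RLess i j) \<longleftrightarrow> True"
| "wf_rfm ar (RRel r is) \<longleftrightarrow> length is = ar r"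
| "wf_rfm ar (RNeg p) \<longleftrightarrow> wf_rfm ar p"
| "wf_rfm ar (RAnd p q) \<longleftrightarrow> wf_rfm ar p \<and> wf_rfm ar q"
| "wf_rfm ar (RAll i p) \<longleftrightarrow> wf_rfm ar p"

fun fv_rfm :: "'r rfm \<Rightarrow> nat set" where
  "fv_rfm (REq i j) = {i, j}"
| "fv_rfm (RLess i j) = {i, j}"
| "fv_rfm (RRel r is) = set is"
| "fv_rfm (RNeg p) = fv_rfm p"
| "fv_rfm (RAnd p q) = fv_rfm p \<union> fv_rfm q"
| "fv_rfm (RAll i p) = fv_rfm p - {i}"

fun rsat :: "('r, 'a) rstruct \<Rightarrow> ('a \<times> 'a) set \<Rightarrow> (nat \<Rightarrow> 'a) \<Rightarrow> 'r rfm \<Rightarrow> bool" where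
  "rsat B lt \<sigma> (REq i j) \<longleftrightarrow> \<sigma> i = \<sigma> j"
| "rsat B lt \<sigma> (RLess i j) \<longleftrightarrow> (\<sigma> i, \<sigma> j) \<in> lt"
| "rsat B lt \<sigma> (RRel r is) \<longleftrightarrow> map \<sigma> is \<in> rel B r"
| "rsat B lt \<sigma> (RNeg p) \<longleftrightarrow> \<not> rsat B lt \<sigma> p"
| "rsat B lt \<sigma> (RAnd p q) \<longleftrightarrow> rsat B lt \<sigma> p \<and> rsat B lt \<sigma> q"
| "rsat B lt \<sigma> (RAll i p) \<longleftrightarrow> (\<forall>d \<in> dom_of B. rsat B lt (\<sigma>(i := d)) p)"

text \<open>
  In a query of dimension \<open>n\<close> with \<open>m\<close> parameters, the variables \<open>0, \<dots>, m - 1\<close> are the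
  parameters \<open>y\<^sub>1, \<dots>, y\<^sub>m\<close>, and the variables \<open>m + i * n, \<dots>, m + i * n + (n - 1)\<close> form the
  tuple of variables standing for the argument number \<open>i\<close> (counted from \<open>0\<close>).
\<close>

record ('r, 's) query =
  dim :: nat
  univ_fm :: "'r rfm"
  rel_fm :: "'s \<Rightarrow> 'r rfm"

definition fo_query ::
    "('r \<Rightarrow> nat) \<Rightarrow> ('s \<Rightarrow> nat) \<Rightarrow> nat \<Rightarrow> ('r, 's) query \<Rightarrow> bool" where
  "fo_query arR arS m Q \<longleftrightarrow>
     wf_rfm arR (univ_fm Q) \<and> fv_rfm (univ_fm Q) \<subseteq> {..<m + dim Q} \<and>
     (\<forall>s. wf_rfm arR (rel_fm Q s) \<and> fv_rfm (rel_fm Q s) \<subseteq> {..<m + arS s * dim Q})"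

definition query_universe ::
    "('r, 's) query \<Rightarrow> 'a list \<Rightarrow> ('r, 'a) rstruct \<Rightarrow> ('a \<times> 'a) set \<Rightarrow> 'a list set" where
  "query_universe Q ps B lt =
     {t \<in> lists (dom_of B). length t = dim Q \<and> rsat B lt (nth (ps @ t)) (univ_fm Q)}"

definition query_struct ::
    "('s \<Rightarrow> nat) \<Rightarrow> ('r, 's) query \<Rightarrow> 'a list \<Rightarrow> ('r, 'a) rstruct \<Rightarrow> ('a \<times> 'a) set
       \<Rightarrow> ('s, 'a list) rstruct" where
  "query_struct arS Q ps B lt =
     \<lparr>dom_of = query_universe Q ps B lt,
      rel = (\<lambda>s. {ts \<in> lists (query_universe Q ps B lt).
                   length ts = arS s \<and> rsat B lt (nth (ps @ concat ts)) (rel_fm Q s)})\<rparr>"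

text \<open>
  The order on the universe is required to be a strict linear order that is well-founded.  On a
  finite universe every strict linear order is; on an infinite universe a quotient need not be
  definable in the expansion by an arbitrary linear order, but suitable orders always exist.
\<close>

definition strict_well_order :: "'a set \<Rightarrow> ('a \<times> 'a) set \<Rightarrow> bool" where
  "strict_well_order X lt \<longleftrightarrow> lt \<subseteq> X \<times> X \<and> strict_linear_order_on X lt \<and> wf lt"

lemma strict_well_order_finite:
  assumes "finite X"
  shows "strict_well_order X lt \<longleftrightarrow> lt \<subseteq> X \<times> X \<and> strict_linear_order_on X lt"
  using assms finite_subset[of lt "X \<times> X"]
  by (auto simp: strict_well_order_def strict_linear_order_on_def acyclic_irrefl
      intro!: finite_acyclic_wf)

lemma strict_well_order_exists: "\<exists>lt. strict_well_order X lt"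
proof -
  obtain r where r: "well_order_on X r"
    using Zorn.well_order_on by blast
  then have "strict_well_order X (r - Id)"
    using well_order_on_domain[OF r]
    by (auto simp: strict_well_order_def well_order_on_def intro: strict_linear_order_on_diff_Id)
  then show ?thesis by blast
qed

end

(*
  Since the congruence theta defined by pi_{a,b} is maximal without (a,b), every nontrivial
  congruence of the quotient pulls back to a congruence of A that contains (a,b); hence the
  classes of a and b generate the monolith.  The quotient is realised inside A on the set of
  order-least representatives of the theta-classes, which is first order definable from pi and
  the order; an operation sends representatives to the least representative of its value in A.
*)

theory Submission
  imports Defs
begin

section \<open>Congruences and quotients\<close>

text \<open>A query sees only the graphs of the operations, while \<open>\<pi>\<close> may contain
  nested terms. The translation therefore names every intermediate value by a quantified variable;
  operations are total functions, so each such value exists and is unique. Keeping these variables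
  apart from the parameters and arguments of the query is the main bookkeeping, done by a renaming
  and a bound above all variables in use. Leastness is expressed only once, in the formula for the
  universe. The formulas for the operations merely ask that the output be related to the value
  computed in \<open>A\<close>: after restriction to the representatives exactly one output
  satisfies this. The monolith is treated for an arbitrary surjective homomorphism with kernel
  \<open>\<theta>\<close>, so that the result applies to the algebra on representatives itself and
  nothing is carried along an isomorphism.\<close>

lemma congruence_equiv: "congruence ar A \<theta> \<Longrightarrow> equiv (universe A) \<theta>"
  by (simp add: congruence_def)

lemma congruence_opn:
  "congruence ar A \<theta> \<Longrightarrow> length xs = ar f \<Longrightarrow> list_all2 (\<lambda>x y. (x, y) \<in> \<theta>) xs ys
    \<Longrightarrow> (opn A f xs, opn A f ys) \<in> \<theta>"
  by (simp add: congruence_def)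

lemma congruence_subset: "congruence ar A \<theta> \<Longrightarrow> \<theta> \<subseteq> universe A \<times> universe A"
  by (auto simp: congruence_def equiv_def refl_on_def)

lemma algebra_opn:
  "algebra ar A \<Longrightarrow> xs \<in> lists (universe A) \<Longrightarrow> length xs = ar f \<Longrightarrow> opn A f xs \<in> universe A"
  by (simp add: algebra_def)

lemma list_all2_in_lists:
  assumes "list_all2 (\<lambda>x y. (x, y) \<in> R) xs ys" "R \<subseteq> X \<times> X"
  shows "xs \<in> lists X" "ys \<in> lists X"
  using assms by (induction rule: list_all2_induct) auto

text \<open>Guarantees that the family intersected in \<open>generated_congruence\<close> is
  nonempty; an empty intersection would be \<open>UNIV\<close> instead of a relation on the
  universe.\<close>

lemma congruence_full:
  assumes "algebra ar A"
  shows "congruence ar A (universe A \<times> universe A)"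
proof -
  have "(opn A f xs, opn A f ys) \<in> universe A \<times> universe A"
    if "length xs = ar f" "list_all2 (\<lambda>x y. (x, y) \<in> universe A \<times> universe A) xs ys" for f xs ys
    using algebra_opn[OF assms] list_all2_in_lists[OF that(2)] list_all2_lengthD[OF that(2)] that(1)
    by auto
  then show ?thesis
    by (auto simp: congruence_def equiv_def refl_on_def sym_def trans_def)
qed

lemma congruence_Inter:
  assumes "S \<noteq> {}" and cong: "\<And>\<theta>. \<theta> \<in> S \<Longrightarrow> congruence ar A \<theta>"
  shows "congruence ar A (\<Inter>S)"
  unfolding congruence_def
proof (intro conjI allI impI)
  have *: "equiv (universe A) \<theta>" if "\<theta> \<in> S" for \<theta>
    using congruence_equiv[OF cong[OF that]] .
  show "equiv (universe A) (\<Inter>S)"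
  proof (rule equivI)
    show "\<Inter>S \<subseteq> universe A \<times> universe A"
      using assms(1) congruence_subset[OF cong] by blast
    show "refl_on (universe A) (\<Inter>S)"
      using * unfolding equiv_def refl_on_def by blast
    show "sym (\<Inter>S)"
      using * unfolding equiv_def sym_def by blast
    show "trans (\<Inter>S)"
      using * unfolding equiv_def trans_def by blast
  qed
  fix f xs ys
  assume "length xs = ar f" "list_all2 (\<lambda>x y. (x, y) \<in> \<Inter>S) xs ys"
  moreover from this(2) have "list_all2 (\<lambda>x y. (x, y) \<in> \<theta>) xs ys" if "\<theta> \<in> S" for \<theta>
    by (rule list_all2_mono) (use that in blast)
  ultimately show "(opn A f xs, opn A f ys) \<in> \<Inter>S"
    using congruence_opn[OF cong] by blast
qed

lemma congruence_generated_congruence: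
  assumes "algebra ar A" "a \<in> universe A" "b \<in> universe A"
  shows "congruence ar A (generated_congruence ar A a b)"
  unfolding generated_congruence_def
  by (rule congruence_Inter) (use assms congruence_full in auto)

lemma congruence_preimage:
  assumes alg: "algebra ar A" and hom: "alg_hom ar g A B" and cong: "congruence ar B \<psi>"
  shows "congruence ar A {(x, y). x \<in> universe A \<and> y \<in> universe A \<and> (g x, g y) \<in> \<psi>}"
    (is "congruence ar A ?R")
  unfolding congruence_def
proof (intro conjI allI impI)
  have g: "g x \<in> universe B" if "x \<in> universe A" for x
    using hom that by (auto simp: alg_hom_def)
  have eq: "equiv (universe B) \<psi>"
    using cong by (rule congruence_equiv)
  show "equiv (universe A) ?R"
  proof (rule equivI)
    show "?R \<subseteq> universe A \<times> universe A" by auto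
    show "refl_on (universe A) ?R"
      using eq g by (auto simp: equiv_def refl_on_def)
    show "sym ?R"
      using eq by (auto simp: equiv_def sym_def)
    show "trans ?R"
      using eq unfolding equiv_def trans_def by blast
  qed
  fix f xs ys
  assume len: "length xs = ar f" and R: "list_all2 (\<lambda>x y. (x, y) \<in> ?R) xs ys"
  have in_lists: "xs \<in> lists (universe A)" "ys \<in> lists (universe A)"
    using list_all2_in_lists[OF R] by auto
  have len': "length ys = ar f"
    using len list_all2_lengthD[OF R] by simp
  have "list_all2 (\<lambda>x y. (x, y) \<in> \<psi>) (map g xs) (map g ys)"
    using R by (auto simp: list_all2_conv_all_nth)
  then have "(opn B f (map g xs), opn B f (map g ys)) \<in> \<psi>"
    using cong len by (intro congruence_opn) auto
  then show "(opn A f xs, opn A f ys) \<in> ?R"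
    using hom in_lists len len' algebra_opn[OF alg] by (simp add: alg_hom_def)
qed

lemma is_monolith_generated_congruence:
  assumes alg: "algebra ar A" "algebra ar B"
    and hom: "alg_hom ar g A B" and surj: "g ` universe A = universe B"
    and ker: "\<And>x y. x \<in> universe A \<Longrightarrow> y \<in> universe A \<Longrightarrow> g x = g y \<longleftrightarrow> (x, y) \<in> \<theta>"
    and max: "max_not_containing ar A a b \<theta>"
    and ab: "a \<in> universe A" "b \<in> universe A"
  shows "is_monolith ar B (generated_congruence ar B (g a) (g b))"
  unfolding is_monolith_def
proof (intro conjI allI impI)
  have g: "g a \<in> universe B" "g b \<in> universe B"
    using surj ab by auto
  show "congruence ar B (generated_congruence ar B (g a) (g b))"
    using alg g by (intro congruence_generated_congruence)
  have "g a \<noteq> g b"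
    using ker ab max by (auto simp: max_not_containing_def)
  moreover have "(g a, g b) \<in> generated_congruence ar B (g a) (g b)"
    by (auto simp: generated_congruence_def)
  ultimately show "generated_congruence ar B (g a) (g b) \<noteq> Id_on (universe B)"
    by auto
  fix \<psi> assume \<psi>: "congruence ar B \<psi>" "\<psi> \<noteq> Id_on (universe B)"
  let ?R = "{(x, y). x \<in> universe A \<and> y \<in> universe A \<and> (g x, g y) \<in> \<psi>}"
  have refl: "Id_on (universe B) \<subseteq> \<psi>"
    using congruence_equiv[OF \<psi>(1)] by (auto simp: equiv_def refl_on_def)
  have sub: "\<theta> \<subseteq> ?R"
  proof
    fix p assume p: "p \<in> \<theta>"
    have "\<theta> \<subseteq> universe A \<times> universe A"
      using max by (auto simp: max_not_containing_def dest: congruence_subset)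
    with p obtain x y where xy: "p = (x, y)" "x \<in> universe A" "y \<in> universe A"
      by auto
    with p have "g x = g y" using ker by simp
    with xy refl surj show "p \<in> ?R" by auto
  qed
  \<comment> \<open>A pair of \<open>\<psi>\<close> off the diagonal, lifted along the surjection,
    has distinct images and so lies outside the kernel \<open>\<theta>\<close>. Hence
    \<open>?R\<close> properly extends \<open>\<theta>\<close>, and maximality puts
    \<open>(a, b)\<close> into it.\<close>
  obtain x y where "(x, y) \<in> \<psi>" "(x, y) \<notin> Id_on (universe B)"
    using \<psi>(2) refl by auto
  moreover from this(1) have "x \<in> universe B" "y \<in> universe B"
    using congruence_subset[OF \<psi>(1)] by auto
  moreover from this obtain x' y' where
    "x' \<in> universe A" "y' \<in> universe A" "x = g x'" "y = g y'"
    unfolding surj[symmetric] by blast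
  ultimately have "(x', y') \<in> ?R" "(x', y') \<notin> \<theta>"
    using ker[of x' y'] by (auto simp: Id_on_iff)
  then have "?R \<noteq> \<theta>" by blast
  then have "(a, b) \<in> ?R"
    using max sub congruence_preimage[OF alg(1) hom \<psi>(1)]
    unfolding max_not_containing_def by blast
  then show "generated_congruence ar B (g a) (g b) \<subseteq> \<psi>"
    using \<psi>(1) by (auto simp: generated_congruence_def)
qed

text \<open>Two monoliths are both nontrivial congruences, so each lies below the other.\<close>

lemma subdirectly_irreducible_if_monolith: "is_monolith ar A \<mu> \<Longrightarrow> subdirectly_irreducible ar A"
  unfolding subdirectly_irreducible_def
  by (rule ex1I[of _ \<mu>]) (auto simp: is_monolith_def)

lemma mem_listset_iff: "ys \<in> listset Xs \<longleftrightarrow> list_all2 (\<in>) ys Xs"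
  by (induction Xs arbitrary: ys) (auto simp: set_Cons_def list_all2_Cons2)

lemma opn_quotient_alg:
  assumes cong: "congruence ar A \<theta>" and xs: "xs \<in> lists (universe A)" "length xs = ar f"
  shows "opn (quotient_alg A \<theta>) f (map (\<lambda>x. \<theta> `` {x}) xs) = \<theta> `` {opn A f xs}"
proof -
  have eq: "equiv (universe A) \<theta>"
    using cong by (rule congruence_equiv)
  \<comment> \<open>The union below is over a constant family; it equals that constant because
    \<open>xs\<close> itself is an index.\<close>
  have "xs \<in> listset (map (\<lambda>x. \<theta> `` {x}) xs)"
    using xs eq by (auto simp: mem_listset_iff list_all2_conv_all_nth equiv_def refl_on_def)
  moreover have "\<theta> `` {opn A f ys} = \<theta> `` {opn A f xs}"
    if "ys \<in> listset (map (\<lambda>x. \<theta> `` {x}) xs)" for ys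
  proof -
    have "list_all2 (\<lambda>x y. (x, y) \<in> \<theta>) xs ys"
      using that by (auto simp: mem_listset_iff list_all2_conv_all_nth)
    then have "(opn A f xs, opn A f ys) \<in> \<theta>"
      using cong xs by (intro congruence_opn)
    then show ?thesis
      using equiv_class_eq[OF eq] by simp
  qed
  ultimately show ?thesis
    unfolding quotient_alg_def alg.simps by (intro UN_constant_eq ballI)
qed

section \<open>The algebra on a system of representatives\<close>

text \<open>Representatives are wrapped into singleton lists because a query of dimension \<open>1\<close>
  defines a structure of 1-tuples.\<close>

definition transversal_alg :: "('f, 'a) alg \<Rightarrow> ('a \<Rightarrow> 'a) \<Rightarrow> ('f, 'a list) alg" where
  "transversal_alg A r =
     \<lparr>universe = (\<lambda>x. [r x]) ` universe A, opn = (\<lambda>f ts. [r (opn A f (concat ts))])\<rparr>"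

text \<open>For an equivalence on \<open>X\<close> this says that \<open>r\<close> is the quotient
  map followed by a section of it. Isolating the two properties keeps the algebra independent of the
  order, which enters only with \<open>least_rep\<close>.\<close>

definition choice_of_reps :: "'a set \<Rightarrow> ('a \<times> 'a) set \<Rightarrow> ('a \<Rightarrow> 'a) \<Rightarrow> bool" where
  "choice_of_reps X \<theta> r \<longleftrightarrow> (\<forall>x \<in> X. (x, r x) \<in> \<theta>) \<and> (\<forall>(x, y) \<in> \<theta>. r x = r y)"

text \<open>Identifies the kernel of \<open>r\<close>, which is what the monolith argument asks of a
  quotient map.\<close>

lemma choice_of_reps_eq_iff:
  assumes "equiv X \<theta>" "choice_of_reps X \<theta> r" "x \<in> X" "y \<in> X"
  shows "r x = r y \<longleftrightarrow> (x, y) \<in> \<theta>"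
proof
  assume "r x = r y"
  moreover have "(x, r x) \<in> \<theta>" "(y, r y) \<in> \<theta>"
    using assms by (auto simp: choice_of_reps_def)
  ultimately show "(x, y) \<in> \<theta>"
    using assms(1) by (metis equiv_def symE transE)
qed (use assms in \<open>auto simp: choice_of_reps_def\<close>)

lemma choice_of_reps_closed:
  "equiv X \<theta> \<Longrightarrow> choice_of_reps X \<theta> r \<Longrightarrow> x \<in> X \<Longrightarrow> r x \<in> X"
  by (fastforce simp: choice_of_reps_def equiv_def)

lemma lists_singletons: "ts \<in> lists ((\<lambda>x. [x]) ` X) \<longleftrightarrow> (\<exists>xs \<in> lists X. ts = map (\<lambda>x. [x]) xs)"
  by (simp add: lists_image image_iff)

lemma concat_map_singleton_id: "concat (map (\<lambda>x. [x]) xs) = xs"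
  by (induction xs) auto

lemma universe_transversal_alg: "universe (transversal_alg A r) = (\<lambda>x. [x]) ` r ` universe A"
  by (auto simp: transversal_alg_def)

lemma opn_transversal_alg: "opn (transversal_alg A r) f (map (\<lambda>x. [x]) xs) = [r (opn A f xs)]"
  by (simp add: transversal_alg_def concat_map_singleton_id)

context
  fixes ar :: "'f \<Rightarrow> nat" and A :: "('f, 'a) alg" and \<theta> r
  assumes alg: "algebra ar A" and cong: "congruence ar A \<theta>"
    and reps: "choice_of_reps (universe A) \<theta> r"
begin

lemmas reps_closed = choice_of_reps_closed[OF congruence_equiv[OF cong] reps]
lemmas reps_eq_iff = choice_of_reps_eq_iff[OF congruence_equiv[OF cong] reps]

lemma reps_related: "x \<in> universe A \<Longrightarrow> (x, r x) \<in> \<theta>"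
  using reps by (auto simp: choice_of_reps_def)

lemma lists_transversal_algE:
  assumes "ts \<in> lists (universe (transversal_alg A r))"
  obtains xs where "xs \<in> lists (universe A)" "ts = map (\<lambda>x. [x]) xs"
proof -
  obtain xs where xs: "xs \<in> lists (r ` universe A)" "ts = map (\<lambda>x. [x]) xs"
    using assms unfolding universe_transversal_alg lists_singletons by (elim bexE)
  have "r ` universe A \<subseteq> universe A"
    using reps_closed by (rule image_subsetI)
  then show thesis
    using xs that lists_mono by blast
qed

lemma algebra_transversal_alg: "algebra ar (transversal_alg A r)"
  unfolding algebra_def
proof (intro conjI allI ballI impI)
  show "universe (transversal_alg A r) \<noteq> {}"
    using alg by (auto simp: transversal_alg_def algebra_def)
  fix f ts
  assume "ts \<in> lists (universe (transversal_alg A r))" "length ts = ar f"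
  then show "opn (transversal_alg A r) f ts \<in> universe (transversal_alg A r)"
    using algebra_opn[OF alg]
    by (elim lists_transversal_algE) (auto simp: opn_transversal_alg universe_transversal_alg)
qed

text \<open>Replacing arguments by their representatives changes the value of an operation only
  within its class, and \<open>r\<close> does not distinguish members of a class.\<close>

lemma alg_hom_transversal_alg: "alg_hom ar (\<lambda>x. [r x]) A (transversal_alg A r)"
  unfolding alg_hom_def
proof (intro conjI allI ballI impI)
  show "(\<lambda>x. [r x]) ` universe A \<subseteq> universe (transversal_alg A r)"
    by (auto simp: transversal_alg_def)
  fix f xs
  assume xs: "xs \<in> lists (universe A)" "length xs = ar f"
  have "list_all2 (\<lambda>x y. (x, y) \<in> \<theta>) xs (map r xs)"
    using xs reps_related by (auto simp: list_all2_conv_all_nth)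
  then have "(opn A f xs, opn A f (map r xs)) \<in> \<theta>"
    using cong xs by (intro congruence_opn)
  then have "r (opn A f xs) = r (opn A f (map r xs))"
    using reps by (auto simp: choice_of_reps_def)
  then show "[r (opn A f xs)] = opn (transversal_alg A r) f (map (\<lambda>x. [r x]) xs)"
    using opn_transversal_alg[of A r f "map r xs"] by (simp add: comp_def)
qed

lemma class_of_rep: "x \<in> universe A \<Longrightarrow> \<theta> `` {r x} = \<theta> `` {x}"
  using equiv_class_eq[OF congruence_equiv[OF cong] reps_related] by simp

text \<open>Injective because equal classes have equal representatives, surjective because each
  class is the class of its representative.\<close>

lemma alg_iso_transversal_alg:
  "alg_iso ar (\<lambda>t. \<theta> `` {hd t}) (transversal_alg A r) (quotient_alg A \<theta>)"
  unfolding alg_iso_def alg_hom_def bij_betw_def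
proof (intro conjI allI ballI impI)
  let ?h = "\<lambda>t. \<theta> `` {hd t}"
  show img: "?h ` universe (transversal_alg A r) = universe (quotient_alg A \<theta>)"
    using class_of_rep
    by (auto simp: transversal_alg_def quotient_alg_def quotient_def image_image)
  then show "?h ` universe (transversal_alg A r) \<subseteq> universe (quotient_alg A \<theta>)"
    by simp
  show "inj_on ?h (universe (transversal_alg A r))"
    using class_of_rep reps_eq_iff eq_equiv_class_iff[OF congruence_equiv[OF cong]]
    by (auto simp: transversal_alg_def inj_on_def)
  fix f ts
  assume ts: "ts \<in> lists (universe (transversal_alg A r))" "length ts = ar f"
  from ts(1) obtain xs where xs: "xs \<in> lists (universe A)" "ts = map (\<lambda>x. [x]) xs"
    by (rule lists_transversal_algE)
  have "?h (opn (transversal_alg A r) f ts) = \<theta> `` {opn A f xs}"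
    using xs ts(2) class_of_rep algebra_opn[OF alg xs(1)] by (simp add: opn_transversal_alg)
  also have "\<dots> = opn (quotient_alg A \<theta>) f (map (\<lambda>x. \<theta> `` {x}) xs)"
    using opn_quotient_alg[OF cong xs(1)] xs(2) ts(2) by simp
  finally show "?h (opn (transversal_alg A r) f ts) = opn (quotient_alg A \<theta>) f (map ?h ts)"
    using xs(2) by (simp add: comp_def)
qed

end

section \<open>Least representatives\<close>

text \<open>The absence of a smaller related element is the form that the universe formula of the
  query takes. An element related to nothing satisfies it vacuously, so it is always paired with
  membership in the carrier or in a class.\<close>

definition least_in_class :: "('a \<times> 'a) set \<Rightarrow> ('a \<times> 'a) set \<Rightarrow> 'a \<Rightarrow> bool" where
  "least_in_class lt \<theta> x \<longleftrightarrow> (\<forall>y. (x, y) \<in> \<theta> \<longrightarrow> (y, x) \<notin> lt)"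

definition least_rep :: "('a \<times> 'a) set \<Rightarrow> ('a \<times> 'a) set \<Rightarrow> 'a \<Rightarrow> 'a" where
  "least_rep lt \<theta> x = (THE y. (x, y) \<in> \<theta> \<and> least_in_class lt \<theta> y)"

text \<open>Well-foundedness gives a minimal member of the class. Two minimal members are related,
  so neither is below the other, and totality makes them equal.\<close>

lemma ex1_least_in_class:
  assumes eq: "equiv X \<theta>" and lt: "strict_well_order X lt" and x: "x \<in> X"
  shows "\<exists>!y. (x, y) \<in> \<theta> \<and> least_in_class lt \<theta> y"
proof -
  have sym: "(v, u) \<in> \<theta>" if "(u, v) \<in> \<theta>" for u v
    using eq that by (simp add: equiv_def sym_def)
  have trans: "(u, w) \<in> \<theta>" if "(u, v) \<in> \<theta>" "(v, w) \<in> \<theta>" for u v w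
    using eq that unfolding equiv_def by (elim conjE transD)
  have total: "u = v \<or> (u, v) \<in> lt \<or> (v, u) \<in> lt" if "u \<in> X" "v \<in> X" for u v
    using lt that by (auto simp: strict_well_order_def strict_linear_order_on_def total_on_def)
  have "x \<in> {y. (x, y) \<in> \<theta>}"
    using eq x by (auto simp: equiv_def refl_on_def)
  moreover have "wf lt"
    using lt by (simp add: strict_well_order_def)
  ultimately obtain y where y: "(x, y) \<in> \<theta>" "\<And>z. (z, y) \<in> lt \<Longrightarrow> (x, z) \<notin> \<theta>"
    by (elim wfE_min[of lt x "{y. (x, y) \<in> \<theta>}"]) auto
  show ?thesis
  proof (rule ex1I)
    show "(x, y) \<in> \<theta> \<and> least_in_class lt \<theta> y"
      using y trans unfolding least_in_class_def by blast
    fix z assume z: "(x, z) \<in> \<theta> \<and> least_in_class lt \<theta> z"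
    then have "(z, y) \<in> \<theta>"
      using y(1) sym trans by blast
    moreover have "z \<in> X" "y \<in> X"
      using z y(1) eq by (auto simp: equiv_def)
    ultimately show "z = y"
      using total[of z y] z y(2) unfolding least_in_class_def by blast
  qed
qed

lemma choice_of_reps_least_rep:
  assumes eq: "equiv X \<theta>" and lt: "strict_well_order X lt"
  shows "choice_of_reps X \<theta> (least_rep lt \<theta>)"
  unfolding choice_of_reps_def
proof (intro conjI ballI, goal_cases)
  case (1 x)
  then show ?case
    unfolding least_rep_def using theI'[OF ex1_least_in_class[OF eq lt]] by blast
next
  case (2 p)
  obtain x y where p: "p = (x, y)" by force
  \<comment> \<open>The description inside \<open>least_rep\<close> depends on the argument only
    through its class.\<close>
  with 2 have "\<theta> `` {x} = \<theta> `` {y}"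
    using equiv_class_eq[OF eq] by simp
  then have "(x, z) \<in> \<theta> \<longleftrightarrow> (y, z) \<in> \<theta>" for z
    by blast
  then show ?case
    by (simp add: p least_rep_def)
qed

text \<open>A least element is its own representative; this turns the image of a choice function
  into a set that a formula can define.\<close>

lemma least_rep_image:
  assumes eq: "equiv X \<theta>" and lt: "strict_well_order X lt"
  shows "least_rep lt \<theta> ` X = {x \<in> X. least_in_class lt \<theta> x}"
proof -
  have *: "(x, least_rep lt \<theta> x) \<in> \<theta> \<and> least_in_class lt \<theta> (least_rep lt \<theta> x)" if "x \<in> X" for x
    unfolding least_rep_def using theI'[OF ex1_least_in_class[OF eq lt that]] .
  have "least_rep lt \<theta> x = x" if "x \<in> X" "least_in_class lt \<theta> x" for x
  proof -
    have "(x, x) \<in> \<theta>"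
      using eq that(1) by (auto simp: equiv_def refl_on_def)
    then show ?thesis
      unfolding least_rep_def
      using that(2) by (intro the1_equality[OF ex1_least_in_class[OF eq lt that(1)]]) simp
  qed
  moreover have "least_rep lt \<theta> x \<in> X" if "x \<in> X" for x
    using *[OF that] eq by (auto simp: equiv_def)
  moreover have "least_in_class lt \<theta> (least_rep lt \<theta> x)" if "x \<in> X" for x
    using *[OF that] by simp
  ultimately show ?thesis
    by (auto intro: rev_image_eqI)
qed

section \<open>Translation into the relational signature\<close>

abbreviation REx :: "nat \<Rightarrow> 'r rfm \<Rightarrow> 'r rfm" where
  "REx i p \<equiv> RNeg (RAll i (RNeg p))"

text \<open>
  The map \<open>\<rho>\<close> renames the variables of the source formula, and \<open>n\<close> is a bound on the variables
  in use, so that \<open>n\<close> itself can serve as a fresh bound variable.  \<open>rel_trm \<rho> n i t\<close> expresses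
  that variable \<open>i\<close> is the value of \<open>t\<close>; in \<open>rel_app\<close> the variables \<open>vs\<close> hold the values
  of the arguments of \<open>f\<close> that were already processed.
\<close>

fun rel_trm :: "(nat \<Rightarrow> nat) \<Rightarrow> nat \<Rightarrow> nat \<Rightarrow> 'f trm \<Rightarrow> 'f rfm"
  and rel_app :: "(nat \<Rightarrow> nat) \<Rightarrow> nat \<Rightarrow> nat \<Rightarrow> 'f \<Rightarrow> nat list \<Rightarrow> 'f trm list \<Rightarrow> 'f rfm" where
  "rel_trm \<rho> n i (Var j) = REq i (\<rho> j)"
| "rel_trm \<rho> n i (App f ts) = rel_app \<rho> n i f [] ts"
| "rel_app \<rho> n i f vs [] = RRel f (vs @ [i])"
| "rel_app \<rho> n i f vs (t # ts) =
     REx n (RAnd (rel_trm \<rho> (Suc n) n t) (rel_app \<rho> (Suc n) i f (vs @ [n]) ts))"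

text \<open>Relational atoms contain no terms, so an equation becomes the existence of a common
  value. A bound variable is renamed to the fresh \<open>n\<close>, which prevents capture by the
  quantifiers that the translation introduces.\<close>

fun rel_afm :: "(nat \<Rightarrow> nat) \<Rightarrow> nat \<Rightarrow> 'f afm \<Rightarrow> 'f rfm" where
  "rel_afm \<rho> n (AEq s t) = REx n (RAnd (rel_trm \<rho> (Suc n) n s) (rel_trm \<rho> (Suc n) n t))"
| "rel_afm \<rho> n (ANeg p) = RNeg (rel_afm \<rho> n p)"
| "rel_afm \<rho> n (AAnd p q) = RAnd (rel_afm \<rho> n p) (rel_afm \<rho> n q)"
| "rel_afm \<rho> n (AAll i p) = RAll n (rel_afm (\<rho>(i := n)) (Suc n) p)"

lemma wf_rel_trm:
  fixes t :: "'f trm" and ts :: "'f trm list"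
  shows
  "wf_trm ar t \<Longrightarrow> wf_rfm (\<lambda>f. Suc (ar f)) (rel_trm \<rho> n i t)"
  "length vs + length ts = ar f \<Longrightarrow> \<forall>t \<in> set ts. wf_trm ar t \<Longrightarrow>
    wf_rfm (\<lambda>f. Suc (ar f)) (rel_app \<rho> n i f vs ts)"
  by (induction \<rho> n i t and \<rho> n i f vs ts rule: rel_trm_rel_app.induct) auto

lemma wf_rel_afm: "wf_afm ar p \<Longrightarrow> wf_rfm (\<lambda>f. Suc (ar f)) (rel_afm \<rho> n p)"
  by (induction p arbitrary: \<rho> n) (auto simp: wf_rel_trm)

lemma fv_rel_trm:
  fixes t :: "'f trm" and ts :: "'f trm list"
  shows
  "fv_rfm (rel_trm \<rho> n i t) \<subseteq> \<rho> ` fv_trm t \<union> {i}"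
  "fv_rfm (rel_app \<rho> n i f vs ts) \<subseteq> \<rho> ` (\<Union>t \<in> set ts. fv_trm t) \<union> {i} \<union> set vs"
  by (induction \<rho> n i t and \<rho> n i f vs ts rule: rel_trm_rel_app.induct) (simp; blast)+

lemma fv_rel_afm: "fv_rfm (rel_afm \<rho> n p) \<subseteq> \<rho> ` fv_afm p"
proof (induction p arbitrary: \<rho> n)
  case (AEq s t)
  show ?case
    using fv_rel_trm(1)[of \<rho> "Suc n" n] by fastforce
next
  case (AAll i p)
  show ?case
    \<comment> \<open>The image of \<open>i\<close> under the new renaming is \<open>n\<close>, the
      variable bound by \<open>RAll\<close>; removing it leaves only images of the other free
      variables.\<close>
    using AAll[of "\<rho>(i := n)" "Suc n"] unfolding fv_rfm.simps fv_afm.simps rel_afm.simps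
    by (rule subset_trans[OF Diff_mono[OF _ order_refl]]) auto
qed (simp; blast)+

section \<open>Coincidence of evaluations and correctness of the translation\<close>

lemma val_cong: "(\<And>i. i \<in> fv_trm t \<Longrightarrow> \<sigma> i = \<tau> i) \<Longrightarrow> val A \<sigma> t = val A \<tau> t"
proof (induction t)
  case (App f ts)
  then have "map (val A \<sigma>) ts = map (val A \<tau>) ts" by auto
  then show ?case by (simp del: map_eq_conv)
qed simp

lemma asat_cong: "(\<And>i. i \<in> fv_afm p \<Longrightarrow> \<sigma> i = \<tau> i) \<Longrightarrow> asat A \<sigma> p \<longleftrightarrow> asat A \<tau> p"
proof (induction p arbitrary: \<sigma> \<tau>)
  case (AEq s t)
  then have "val A \<sigma> s = val A \<tau> s" "val A \<sigma> t = val A \<tau> t"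
    by (auto intro: val_cong)
  then show ?case by simp
next
  case (AAnd p q)
  from AAnd.IH[of \<sigma> \<tau>] AAnd.prems show ?case by simp
next
  case (AAll i p)
  have "asat A (\<sigma>(i := d)) p \<longleftrightarrow> asat A (\<tau>(i := d)) p" for d
    using AAll.prems by (intro AAll.IH) auto
  then show ?case by simp
next
  case (ANeg p)
  from ANeg.IH[of \<sigma> \<tau>] ANeg.prems show ?case by simp
qed

lemma val_closed:
  assumes "algebra ar A" "wf_trm ar t" "range \<sigma> \<subseteq> universe A"
  shows "val A \<sigma> t \<in> universe A"
  using assms(2)
proof (induction t)
  case (App f ts)
  then show ?case
    by (auto intro!: algebra_opn[OF assms(1)])
qed (use assms(3) in auto)

lemma dom_of_graph_struct [simp]: "dom_of (graph_struct ar A) = universe A"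
  by (simp add: graph_struct_def)

lemma rel_graph_struct_iff:
  "xs @ [y] \<in> rel (graph_struct ar A) f \<longleftrightarrow>
    xs \<in> lists (universe A) \<and> length xs = ar f \<and> y = opn A f xs"
  by (auto simp: graph_struct_def)

lemma fun_upd_comp_fresh: "(\<And>j. \<rho> j \<noteq> n) \<Longrightarrow> \<sigma>(n := d) \<circ> \<rho> = \<sigma> \<circ> \<rho>"
  by (auto simp: fun_eq_iff)

context
  fixes ar :: "'f \<Rightarrow> nat" and A :: "('f, 'a) alg" and lt :: "('a \<times> 'a) set"
  assumes alg: "algebra ar A"
begin

text \<open>The only witness for a quantifier introduced by \<open>rel_app\<close> is the value of
  the next argument. Throughout, \<open>vs\<close> and \<open>ts\<close> together have the arity of
  \<open>f\<close>, and all variables in use stay below \<open>n\<close>.\<close>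

lemma rsat_rel_trm:
  "wf_trm ar t \<Longrightarrow> range \<rho> \<subseteq> {..<n} \<Longrightarrow> range (\<sigma> \<circ> \<rho>) \<subseteq> universe A \<Longrightarrow> i < n \<Longrightarrow>
    rsat (graph_struct ar A) lt \<sigma> (rel_trm \<rho> n i t) \<longleftrightarrow> \<sigma> i = val A (\<sigma> \<circ> \<rho>) t"
  "\<forall>t \<in> set ts. wf_trm ar t \<Longrightarrow> range \<rho> \<subseteq> {..<n} \<Longrightarrow> range (\<sigma> \<circ> \<rho>) \<subseteq> universe A \<Longrightarrow> i < n \<Longrightarrow>
    set vs \<subseteq> {..<n} \<Longrightarrow> \<sigma> ` set vs \<subseteq> universe A \<Longrightarrow> length vs + length ts = ar f \<Longrightarrow>
    rsat (graph_struct ar A) lt \<sigma> (rel_app \<rho> n i f vs ts) \<longleftrightarrow>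
      \<sigma> i = opn A f (map \<sigma> vs @ map (val A (\<sigma> \<circ> \<rho>)) ts)"
proof (induction \<rho> n i t and \<rho> n i f vs ts arbitrary: \<sigma> and \<sigma> rule: rel_trm_rel_app.induct)
  case (3 \<rho> n i f vs)
  then show ?case
    using rel_graph_struct_iff[of "map \<sigma> vs" "\<sigma> i" ar A f] by auto
next
  case (4 \<rho> n i f vs t ts)
  have fresh: "\<sigma>(n := d) \<circ> \<rho> = \<sigma> \<circ> \<rho>" for d
    using 4(4) by (intro fun_upd_comp_fresh) auto
  have less: "range \<rho> \<subseteq> {..<Suc n}" using 4(4) by (auto intro: less_SucI)
  let ?v = "val A (\<sigma> \<circ> \<rho>) t"
  \<comment> \<open>Quantifiers range over the universe, so the value qualifies as a witness only if
    it lies there.\<close>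
  have v: "?v \<in> universe A"
    using val_closed[OF alg] 4(3,5) by simp
  have 1: "rsat (graph_struct ar A) lt (\<sigma>(n := d)) (rel_trm \<rho> (Suc n) n t) \<longleftrightarrow> d = ?v" for d
    using 4(3,5) less by (subst 4(1)[of "\<sigma>(n := d)", unfolded fresh]) auto
  have vs: "map (\<sigma>(n := d)) vs = map \<sigma> vs" for d
    using 4(7) by auto
  have "rsat (graph_struct ar A) lt (\<sigma>(n := ?v)) (rel_app \<rho> (Suc n) i f (vs @ [n]) ts) \<longleftrightarrow>
      (\<sigma>(n := ?v)) i = opn A f (map (\<sigma>(n := ?v)) (vs @ [n]) @ map (val A (\<sigma>(n := ?v) \<circ> \<rho>)) ts)"
  proof (rule 4(2))
    show "(\<sigma>(n := ?v)) ` set (vs @ [n]) \<subseteq> universe A"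
      using 4(8) v by auto
    show "set (vs @ [n]) \<subseteq> {..<Suc n}" using 4(7) by auto
    show "range (\<sigma>(n := ?v) \<circ> \<rho>) \<subseteq> universe A" unfolding fresh by (rule 4(5))
  qed (use 4(3,6,9) less in auto)
  also have "\<dots> \<longleftrightarrow> \<sigma> i = opn A f (map \<sigma> vs @ map (val A (\<sigma> \<circ> \<rho>)) (t # ts))"
    using 4(6) fresh vs by (simp del: map_eq_conv)
  finally show ?case
    using 1 v by (auto simp: comp_def)
qed (auto simp: comp_def)

lemma rsat_rel_afm:
  "wf_afm ar p \<Longrightarrow> range \<rho> \<subseteq> {..<n} \<Longrightarrow> range (\<sigma> \<circ> \<rho>) \<subseteq> universe A \<Longrightarrow>
    rsat (graph_struct ar A) lt \<sigma> (rel_afm \<rho> n p) \<longleftrightarrow> asat A (\<sigma> \<circ> \<rho>) p"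
proof (induction p arbitrary: \<rho> n \<sigma>)
  case (AEq s t)
  have fresh: "\<sigma>(n := d) \<circ> \<rho> = \<sigma> \<circ> \<rho>" for d
    using AEq(2) by (intro fun_upd_comp_fresh) auto
  have less: "range \<rho> \<subseteq> {..<Suc n}" using AEq(2) by (auto intro: less_SucI)
  have "rsat (graph_struct ar A) lt (\<sigma>(n := d)) (rel_trm \<rho> (Suc n) n u) \<longleftrightarrow>
      d = val A (\<sigma> \<circ> \<rho>) u" if "wf_trm ar u" for u d
    using rsat_rel_trm(1)[of u \<rho> "Suc n" "\<sigma>(n := d)" n, unfolded fresh] that AEq(3) less by simp
  then show ?case
    using AEq val_closed[OF alg, of s "\<sigma> \<circ> \<rho>"] by (auto simp: comp_def)
next
  case (AAll i p)
  have "rsat (graph_struct ar A) lt (\<sigma>(n := d)) (rel_afm (\<rho>(i := n)) (Suc n) p) \<longleftrightarrow>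
      asat A ((\<sigma> \<circ> \<rho>)(i := d)) p" if d: "d \<in> universe A" for d
  proof -
    \<comment> \<open>Since \<open>\<rho>\<close> avoids \<open>n\<close>, assigning
      \<open>d\<close> to \<open>n\<close> affects exactly the source variable
      \<open>i\<close>.\<close>
    have "\<rho> j \<noteq> n" for j using AAll(3) by auto
    then have eq: "\<sigma>(n := d) \<circ> \<rho>(i := n) = (\<sigma> \<circ> \<rho>)(i := d)"
      by (auto simp: fun_eq_iff)
    have "rsat (graph_struct ar A) lt (\<sigma>(n := d)) (rel_afm (\<rho>(i := n)) (Suc n) p) \<longleftrightarrow>
        asat A (\<sigma>(n := d) \<circ> \<rho>(i := n)) p"
    proof (rule AAll(1))
      show "range (\<sigma>(n := d) \<circ> \<rho>(i := n)) \<subseteq> universe A"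
        unfolding eq using AAll(4) d by (auto split: if_splits)
      show "range (\<rho>(i := n)) \<subseteq> {..<Suc n}"
        using AAll(3) by (auto intro: less_SucI)
    qed (use AAll(2) in simp)
    then show ?thesis unfolding eq .
  qed
  then show ?case by (simp add: comp_def)
next
  case (ANeg p)
  then show ?case by simp
next
  case (AAnd p q)
  from AAnd.IH[of \<rho> n \<sigma>] AAnd.prems show ?case by simp
qed

end

section \<open>The query\<close>

text \<open>Sends every variable beyond the four relevant ones to \<open>q\<close> as well, so that the
  renaming has finite range.\<close>

definition ren :: "nat \<Rightarrow> nat \<Rightarrow> nat \<Rightarrow> nat" where
  "ren p q j = (if j = 0 then 0 else if j = 1 then 1 else if j = 2 then p else q)"

text \<open>Beyond index 3 the renamed evaluation yields \<open>\<sigma> q\<close>, whereas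
  \<open>nth\<close> on a list of length four is unspecified; the two agree on the free variables of
  \<open>\<pi>\<close>.\<close>

lemma rsat_rel_afm_ren:
  assumes "algebra ar A" "wf_afm ar \<pi>" "fv_afm \<pi> \<subseteq> {0, 1, 2, 3}"
    and "1 < n" "p < n" "q < n"
    and "\<sigma> 0 \<in> universe A" "\<sigma> 1 \<in> universe A" "\<sigma> p \<in> universe A" "\<sigma> q \<in> universe A"
  shows "rsat (graph_struct ar A) lt \<sigma> (rel_afm (ren p q) n \<pi>) \<longleftrightarrow>
    asat A (nth [\<sigma> 0, \<sigma> 1, \<sigma> p, \<sigma> q]) \<pi>"
proof -
  have "rsat (graph_struct ar A) lt \<sigma> (rel_afm (ren p q) n \<pi>) \<longleftrightarrow> asat A (\<sigma> \<circ> ren p q) \<pi>"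
    using assms by (intro rsat_rel_afm) (auto simp: ren_def)
  also have "\<dots> \<longleftrightarrow> asat A (nth [\<sigma> 0, \<sigma> 1, \<sigma> p, \<sigma> q]) \<pi>"
  proof (rule asat_cong)
    fix i assume "i \<in> fv_afm \<pi>"
    then have "i \<in> {0, 1, 2, 3}" using assms(3) by blast
    then show "(\<sigma> \<circ> ren p q) i = [\<sigma> 0, \<sigma> 1, \<sigma> p, \<sigma> q] ! i"
      by (auto simp: ren_def numeral_2_eq_2 numeral_3_eq_3)
  qed
  finally show ?thesis .
qed

text \<open>Variables 0 and 1 are the parameters. In the universe formula 2 is the candidate and 3 a
  competitor. For an operation, the arguments start at 2, the output is \<open>2 + ar f\<close>, and
  the quantified \<open>3 + ar f\<close> holds the value computed in the given algebra, to which the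
  output must be related. The bounds 4 and \<open>4 + ar f\<close> are the next free
  indices.\<close>

definition least_reps_query :: "('f \<Rightarrow> nat) \<Rightarrow> 'f afm \<Rightarrow> ('f, 'f) query" where
  "least_reps_query ar \<pi> =
     \<lparr>dim = 1,
      univ_fm = RAll 3 (RNeg (RAnd (rel_afm (ren 2 3) 4 \<pi>) (RLess 3 2))),
      rel_fm = (\<lambda>f. REx (3 + ar f)
        (RAnd (RRel f ([2..<2 + ar f] @ [3 + ar f]))
              (rel_afm (ren (3 + ar f) (2 + ar f)) (4 + ar f) \<pi>)))\<rparr>"

lemma fo_query_least_reps_query:
  assumes "wf_afm ar \<pi>"
  shows "fo_query (\<lambda>f. Suc (ar f)) (\<lambda>f. Suc (ar f)) 2 (least_reps_query ar \<pi>)"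
proof -
  have fv: "v \<in> {0, 1, p, q}" if v: "v \<in> fv_rfm (rel_afm (ren p q) n \<pi>)" for v p q n
  proof -
    obtain j where "v = ren p q j"
      using subsetD[OF fv_rel_afm v] by (rule imageE)
    then show ?thesis by (simp add: ren_def)
  qed
  have "fv_rfm (univ_fm (least_reps_query ar \<pi>)) \<subseteq> {..<2 + dim (least_reps_query ar \<pi>)}"
    by (auto simp: least_reps_query_def dest!: fv)
  moreover have "fv_rfm (rel_fm (least_reps_query ar \<pi>) f)
      \<subseteq> {..<2 + Suc (ar f) * dim (least_reps_query ar \<pi>)}" for f
    by (auto simp: least_reps_query_def dest!: fv)
  ultimately show ?thesis
    unfolding fo_query_def
    using assms by (simp add: least_reps_query_def wf_rel_afm del: upt_Suc upt_rec_numeral)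
qed

text \<open>On representatives, being related to the value of an operation is the same as being the
  representative of that value. Both structures live on 1-tuples, which makes an equality possible
  instead of an isomorphism.\<close>

lemma graph_struct_least_reps:
  assumes alg: "algebra ar A" and wf: "wf_afm ar \<pi>" "fv_afm \<pi> \<subseteq> {0, 1, 2, 3}"
    and ab: "a \<in> universe A" "b \<in> universe A"
    and lt: "strict_well_order (universe A) lt"
    and \<theta>: "\<theta> = {(c, d). c \<in> universe A \<and> d \<in> universe A \<and> asat A (nth [a, b, c, d]) \<pi>}"
    and cong: "congruence ar A \<theta>"
  shows "graph_struct ar (transversal_alg A (least_rep lt \<theta>)) =
    query_struct (\<lambda>f. Suc (ar f)) (least_reps_query ar \<pi>) [a, b] (graph_struct ar A) lt"
    (is "graph_struct ar ?C = query_struct _ ?Q _ ?G lt")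
proof -
  let ?r = "least_rep lt \<theta>"
  let ?U = "query_universe ?Q [a, b] ?G lt"
  have eq: "equiv (universe A) \<theta>"
    using cong by (rule congruence_equiv)
  have reps: "choice_of_reps (universe A) \<theta> ?r"
    using choice_of_reps_least_rep[OF eq lt] .
  have img: "?r ` universe A = {x \<in> universe A. least_in_class lt \<theta> x}"
    using least_rep_image[OF eq lt] .
  have univ: "rsat ?G lt (nth [a, b, c]) (univ_fm ?Q) \<longleftrightarrow> least_in_class lt \<theta> c"
    if c: "c \<in> universe A" for c
  proof -
    \<comment> \<open>Index 3 is the first position past the end of the list; the update supplies
      the value that \<open>nth\<close> leaves unspecified.\<close>
    have "rsat ?G lt ((nth [a, b, c])(3 := d)) (rel_afm (ren 2 3) 4 \<pi>) \<longleftrightarrow> (c, d) \<in> \<theta>"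
      if d: "d \<in> universe A" for d
      using rsat_rel_afm_ren[OF alg wf, of 4 2 3 "(nth [a, b, c])(3 := d)" lt] ab c d
      by (simp add: \<theta>)
    then show ?thesis
      using \<theta> by (auto simp: least_reps_query_def least_in_class_def)
  qed
  have U: "universe ?C = ?U"
  proof -
    have "?U = {t \<in> lists (universe A). length t = 1 \<and> rsat ?G lt (nth ([a, b] @ t)) (univ_fm ?Q)}"
      by (simp add: query_universe_def least_reps_query_def)
    also have "\<dots> = (\<lambda>x. [x]) ` {x \<in> universe A. least_in_class lt \<theta> x}"
      using univ by (auto simp: length_Suc_conv)
    also have "\<dots> = universe ?C"
      using universe_transversal_alg[of A ?r] img by simp
    finally show ?thesis ..
  qed
  have rel: "rsat ?G lt (nth ([a, b] @ xs @ [y])) (rel_fm ?Q f) \<longleftrightarrow> (opn A f xs, y) \<in> \<theta>"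
    if xs: "xs \<in> lists (universe A)" "length xs = ar f" and y: "y \<in> universe A" for f xs y
  proof -
    have o: "opn A f xs \<in> universe A"
      using algebra_opn[OF alg xs] .
    \<comment> \<open>The list has length \<open>3 + ar f\<close>, so the quantified variable sits
      just past its end and the update disturbs no parameter or argument.\<close>
    let ?\<sigma> = "\<lambda>d. (nth ([a, b] @ xs @ [y]))(3 + ar f := d)"
    have "map (?\<sigma> d) [2..<2 + ar f] = xs" for d
      using xs(2) by (intro nth_equalityI) (auto simp: nth_append simp del: upt_Suc upt_rec_numeral)
    then have 1: "rsat ?G lt (?\<sigma> d) (RRel f ([2..<2 + ar f] @ [3 + ar f])) \<longleftrightarrow> d = opn A f xs" for d
      using rel_graph_struct_iff[of xs d ar A f] xs by simp
    have vals: "?\<sigma> d 0 = a" "?\<sigma> d 1 = b" "?\<sigma> d (3 + ar f) = d" "?\<sigma> d (2 + ar f) = y" for d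
      using xs(2) by (auto simp: nth_append)
    have 2: "rsat ?G lt (?\<sigma> d) (rel_afm (ren (3 + ar f) (2 + ar f)) (4 + ar f) \<pi>)
        \<longleftrightarrow> (d, y) \<in> \<theta>" if d: "d \<in> universe A" for d
      using rsat_rel_afm_ren[OF alg wf, of "4 + ar f" "3 + ar f" "2 + ar f" "?\<sigma> d" lt]
        ab y d unfolding vals by (simp add: \<theta>)
    have "rsat ?G lt (nth ([a, b] @ xs @ [y])) (rel_fm ?Q f) \<longleftrightarrow>
      (\<exists>d \<in> universe A. rsat ?G lt (?\<sigma> d) (RRel f ([2..<2 + ar f] @ [3 + ar f])) \<and>
        rsat ?G lt (?\<sigma> d) (rel_afm (ren (3 + ar f) (2 + ar f)) (4 + ar f) \<pi>))"
      by (simp add: least_reps_query_def)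
    also have "\<dots> \<longleftrightarrow> (\<exists>d \<in> universe A. d = opn A f xs \<and> (d, y) \<in> \<theta>)"
      by (intro bex_cong refl) (simp only: 1 2)
    also have "\<dots> \<longleftrightarrow> (opn A f xs, y) \<in> \<theta>"
      using o by blast
    finally show ?thesis .
  qed
  have rels: "rel (graph_struct ar ?C) f =
    {ts \<in> lists (universe ?C). length ts = Suc (ar f) \<and>
      rsat ?G lt (nth ([a, b] @ concat ts)) (rel_fm ?Q f)}" (is "?L = ?R") for f
  proof (rule set_eqI)
    fix ts :: "'b list list"
    show "ts \<in> ?L \<longleftrightarrow> ts \<in> ?R"
    proof (cases "ts \<in> lists (universe ?C) \<and> length ts = Suc (ar f)")
      case True
      then obtain zs t where ts: "ts = zs @ [t]" "zs \<in> lists (universe ?C)" "t \<in> universe ?C"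
          "length zs = ar f"
        by (cases ts rule: rev_cases) auto
      from ts(2) obtain xs where xs: "xs \<in> lists (universe A)" "zs = map (\<lambda>x. [x]) xs"
        by (rule lists_transversal_algE[OF alg cong reps])
      from ts(3) obtain y where y: "t = [?r y]" "y \<in> universe A"
        by (auto simp: transversal_alg_def)
      have ry: "?r y \<in> universe A"
        using y(2) by (rule choice_of_reps_closed[OF eq reps])
      \<comment> \<open>Here \<open>y\<close> is an arbitrary preimage of \<open>t\<close>; being
        related to \<open>y\<close>, the entry \<open>?r y\<close> is its own
        representative.\<close>
      moreover have "(y, ?r y) \<in> \<theta>"
        using y(2) reps by (simp add: choice_of_reps_def)
      ultimately have rry: "?r y = ?r (?r y)"
        using choice_of_reps_eq_iff[OF eq reps y(2)] by blast
      have len: "length xs = ar f" using xs(2) ts(4) by simp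
      have "ts \<in> ?R \<longleftrightarrow> (opn A f xs, ?r y) \<in> \<theta>"
        using True rel[OF xs(1) len ry] ts(1) xs(2) y(1)
        by (simp add: concat_map_singleton_id)
      also have "\<dots> \<longleftrightarrow> ?r (opn A f xs) = ?r y"
        using choice_of_reps_eq_iff[OF eq reps algebra_opn[OF alg xs(1) len] ry] rry[symmetric] by simp
      also have "\<dots> \<longleftrightarrow> t = opn ?C f zs"
        using xs(2) y(1) by (auto simp: transversal_alg_def concat_map_singleton_id)
      also have "\<dots> \<longleftrightarrow> ts \<in> ?L"
        using ts rel_graph_struct_iff[of zs t ar ?C f] by simp
      finally show ?thesis ..
    next
      case False
      \<comment> \<open>Closure of the representatives under the operations keeps the last
        coordinate of the graph in the universe, so outside such lists both sides are false.\<close>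
      moreover have "?L \<subseteq> {ts \<in> lists (universe ?C). length ts = Suc (ar f)}"
        using algebra_opn[OF algebra_transversal_alg[OF alg cong reps], of _ f]
        by (auto simp: graph_struct_def simp flip: in_lists_conv_set)
      ultimately show ?thesis by blast
    qed
  qed
  show ?thesis
    using U ext[OF rels] by (simp add: query_struct_def graph_struct_def)
qed

theorem theorem3p6:
  fixes ar :: "'f \<Rightarrow> nat" and K :: "('f, 'a) alg set"
  assumes "\<forall>A \<in> K. algebra ar A"
    and "closed_under_hom_images ar K"
    and "definable_cmi_congruences ar K"
  shows "\<exists>Q :: ('f, 'f) query.
    fo_query (\<lambda>f. Suc (ar f)) (\<lambda>f. Suc (ar f)) 2 Q \<and>
    (\<forall>A \<in> K. \<forall>a \<in> universe A. \<forall>b \<in> universe A. \<forall>lt.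
      a \<noteq> b \<longrightarrow> strict_well_order (universe A) lt \<longrightarrow>
      (\<exists>C \<theta> h a' b'.
         algebra ar C \<and>
         graph_struct ar C =
           query_struct (\<lambda>f. Suc (ar f)) Q [a, b] (graph_struct ar A) lt \<and>
         congruence ar A \<theta> \<and>
         alg_iso ar h C (quotient_alg A \<theta>) \<and>
         (\<forall>t \<in> universe C. set t \<subseteq> h t) \<and>
         subdirectly_irreducible ar C \<and>
         a' \<in> universe C \<and> h a' = \<theta> `` {a} \<and>
         b' \<in> universe C \<and> h b' = \<theta> `` {b} \<and>
         is_monolith ar C (generated_congruence ar C a' b')))"
proof -
  obtain \<pi> where \<pi>: "wf_afm ar \<pi>" "fv_afm \<pi> \<subseteq> {0, 1, 2, 3}"
    and max: "\<And>A a b. A \<in> K \<Longrightarrow> a \<in> universe A \<Longrightarrow> b \<in> universe A \<Longrightarrow> a \<noteq> b \<Longrightarrow>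
      max_not_containing ar A a b
        {(c, d). c \<in> universe A \<and> d \<in> universe A \<and> asat A (nth [a, b, c, d]) \<pi>}"
    using assms(3) unfolding definable_cmi_congruences_def by blast
  show ?thesis
  proof (intro exI[of _ "least_reps_query ar \<pi>"] conjI ballI allI impI)
    show "fo_query (\<lambda>f. Suc (ar f)) (\<lambda>f. Suc (ar f)) 2 (least_reps_query ar \<pi>)"
      using \<pi>(1) by (rule fo_query_least_reps_query)
    fix A a b lt
    assume A: "A \<in> K" and ab: "a \<in> universe A" "b \<in> universe A" "a \<noteq> b"
      and lt: "strict_well_order (universe A) lt"
    define \<theta> where
      "\<theta> = {(c, d). c \<in> universe A \<and> d \<in> universe A \<and> asat A (nth [a, b, c, d]) \<pi>}"
    define r where "r = least_rep lt \<theta>"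
    let ?C = "transversal_alg A r"
    have alg: "algebra ar A"
      using assms(1) A by blast
    have max\<theta>: "max_not_containing ar A a b \<theta>"
      using max A ab unfolding \<theta>_def by blast
    then have cong: "congruence ar A \<theta>"
      by (simp add: max_not_containing_def)
    then have eq: "equiv (universe A) \<theta>"
      by (rule congruence_equiv)
    have reps: "choice_of_reps (universe A) \<theta> r"
      unfolding r_def using eq lt by (rule choice_of_reps_least_rep)
    note algC = algebra_transversal_alg[OF alg cong reps]
    have univ: "(\<lambda>x. [r x]) ` universe A = universe ?C"
      by (simp add: transversal_alg_def)
    have mono: "is_monolith ar ?C (generated_congruence ar ?C [r a] [r b])"
      using is_monolith_generated_congruence[OF alg algC alg_hom_transversal_alg[OF alg cong reps]
          univ _ max\<theta> ab(1,2)]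
        choice_of_reps_eq_iff[OF eq reps] by simp
    have "graph_struct ar ?C =
        query_struct (\<lambda>f. Suc (ar f)) (least_reps_query ar \<pi>) [a, b] (graph_struct ar A) lt"
      unfolding r_def by (rule graph_struct_least_reps[OF alg \<pi> ab(1,2) lt \<theta>_def cong])
    \<comment> \<open>By reflexivity the element that forms a 1-tuple lies in the class assigned to
      it, so the isomorphism is the natural one.\<close>
    moreover have "set t \<subseteq> \<theta> `` {hd t}" if "t \<in> universe ?C" for t
      using that eq choice_of_reps_closed[OF eq reps]
      by (auto simp: transversal_alg_def equiv_def refl_on_def)
    \<comment> \<open>The elements \<open>a\<close> and \<open>b\<close> need not be least in their
      classes, so their representatives serve as generators.\<close>
    moreover have "[r a] \<in> universe ?C" "[r b] \<in> universe ?C"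
      using univ ab by auto
    moreover have "\<theta> `` {hd [r a]} = \<theta> `` {a}" "\<theta> `` {hd [r b]} = \<theta> `` {b}"
      using class_of_rep[OF alg cong reps] ab by auto
    ultimately show "\<exists>C \<theta> h a' b'.
         algebra ar C \<and>
         graph_struct ar C =
           query_struct (\<lambda>f. Suc (ar f)) (least_reps_query ar \<pi>) [a, b] (graph_struct ar A) lt \<and>
         congruence ar A \<theta> \<and>
         alg_iso ar h C (quotient_alg A \<theta>) \<and>
         (\<forall>t \<in> universe C. set t \<subseteq> h t) \<and>
         subdirectly_irreducible ar C \<and>
         a' \<in> universe C \<and> h a' = \<theta> `` {a} \<and>
         b' \<in> universe C \<and> h b' = \<theta> `` {b} \<and>
         is_monolith ar C (generated_congruence ar C a' b')"
      using algC cong alg_iso_transversal_alg[OF alg cong reps]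
        subdirectly_irreducible_if_monolith[OF mono] mono
      by (intro exI[of _ ?C] exI[of _ \<theta>] exI[of _ "\<lambda>t. \<theta> `` {hd t}"]
          exI[of _ "[r a]"] exI[of _ "[r b]"] conjI ballI)
  qed
qed

end
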